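(* Consider a fourth-order tensor $\mathcal{F}\in\mathbb{C}^{n_1\times n_2\times n_3\times n_4}$ such that $\mathcal{F}=A\otimes B$ for some matrices $A\in\mathbb{C}^{n_1\times n_2}$ and $B\in\mathbb{C}^{n_3\times n_4}$. Denote $r_1=\operatorname{rank}(A)$ and $r_2=\operatorname{rank}(B)$. Then the following holds: (i) the Tucker rank of $\mathcal{F}$ is $(r_1,r_1,r_2,r_2)$; (ii) $\operatorname{rank}_{M^+}(\mathcal{F})=r_1r_2$ and $\operatorname{rank}_{M^-}(\mathcal{F})=1$; (iii) $\operatorname{rank}_{CP}(\mathcal{F})=r_1r_2$.
   Context: $\otimes$ is the outer product: $(A\otimes B)_{i_1i_2i_3i_4}=A_{i_1i_2}B_{i_3i_4}$. The CP-rank $\operatorname{rank}_{CP}(\mathcal{F})$ of $\mathcal{F}\in\mathbb{C}^{n_1\times\cdots\times n_d}$ is the smallest integer $r$ such that $\mathcal{F}=\sum_{i=1}^r a^{1,i}\otimes\cdots\otimes a^{d,i}$ with $a^{k,i}\in\mathbb{C}^{n_k}$ for $k=1,\dots,d$ and $i=1,\dots,r$. The mode-$j$ matricization $F(j)$ of $\mathcal{F}$ is the matrix obtained by taking the $j$-th index of $\mathcal{F}$ as the column index and merging all other indices into the row index. The Tucker rank of $\mathcal{F}\in\mathbb{C}^{n_1\times\cdots\times n_d}$ is the vector $(\operatorname{rank}(F(1)),\dots,\operatorname{rank}(F(d)))$. The square unfolding of a fourth-order tensor $\mathcal{G}\in\mathbb{C}^{m_1\times m_2\times m_3\times m_4}$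 is the matrix $\boldsymbol{M}(\mathcal{G})\in\mathbb{C}^{(m_1m_2)\times(m_3m_4)}$ with entries $\boldsymbol{M}(\mathcal{G})_{k\ell}=\mathcal{G}_{i_1i_2i_3i_4}$, where $k=(i_2-1)m_1+i_1$ and $\ell=(i_4-1)m_3+i_3$. For a permutation $\pi$ of $(1,2,3,4)$, $\mathcal{F}_\pi$ is the tensor obtained by permuting the indices of $\mathcal{F}$ according to $\pi$. Then $\operatorname{rank}_{M^-}(\mathcal{F})=\min_\pi\operatorname{rank}(\boldsymbol{M}(\mathcal{F}_\pi))$ and $\operatorname{rank}_{M^+}(\mathcal{F})=\max_\pi\operatorname{rank}(\boldsymbol{M}(\mathcal{F}_\pi))$, over all permutations $\pi$ of $(1,2,3,4)$.
   Formalization: Claim (i) is stated only when A and B are both zero or both non-zero, and rank_{M^-}(F)=1 only when A and B are both non-zero; if A=0 and B≠0 then F=0 has Tucker rank (0,0,0,0), and if A or B is zero then rank_{M^-}(F)=0. *)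

theory Defs
  imports Complex_Main "HOL-Library.FuncSet" "HOL-Combinatorics.Permutations"
    "Jordan_Normal_Form.DL_Rank"
begin

text \<open>
  The mode sizes of a tensor vary with the permutation of its indices, so a tensor of size
  \<open>n\<^sub>1 \<times> \<dots> \<times> n\<^sub>d\<close> is represented by a function on multi-indices, accompanied by the list
  \<open>ns = [n\<^sub>1, \<dots>, n\<^sub>d]\<close>; the value outside the index range is \<^const>\<open>undefined\<close>.
  All indices are 0-based, as they are for matrices and vectors in the library.
\<close>

type_synonym 'a tensor = "nat list \<Rightarrow> 'a"

definition tensor_index :: "nat list \<Rightarrow> nat list set" where
  "tensor_index ns = {is. length is = length ns \<and> (\<forall>k<length ns. is ! k < ns ! k)}"

definition carrier_tensor :: "nat list \<Rightarrow> 'a tensor set" where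
  "carrier_tensor ns = tensor_index ns \<rightarrow>\<^sub>E UNIV"

definition mat_rank :: "'a :: field mat \<Rightarrow> nat" where
  "mat_rank A = vec_space.rank (dim_row A) A"

definition mat_outer :: "'a :: semiring_0 mat \<Rightarrow> 'a mat \<Rightarrow> 'a tensor" where
  "mat_outer A B =
     (\<lambda>is \<in> tensor_index [dim_row A, dim_col A, dim_row B, dim_col B].
        A $$ (is ! 0, is ! 1) * B $$ (is ! 2, is ! 3))"

definition vec_outer :: "nat \<Rightarrow> (nat \<Rightarrow> 'a :: comm_semiring_1 vec) \<Rightarrow> 'a tensor" where
  "vec_outer d a =
     (\<lambda>is \<in> tensor_index (map (\<lambda>k. dim_vec (a k)) [0..<d]). \<Prod>k<d. a k $ (is ! k))"

definition rank_CP :: "nat list \<Rightarrow> 'a :: comm_semiring_1 tensor \<Rightarrow> nat" where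
  "rank_CP ns F =
     (LEAST r. \<exists>a :: nat \<Rightarrow> nat \<Rightarrow> 'a vec.
        (\<forall>k<length ns. \<forall>i<r. a k i \<in> carrier_vec (ns ! k)) \<and>
        (\<forall>is\<in>tensor_index ns. F is = (\<Sum>i<r. vec_outer (length ns) (\<lambda>k. a k i) is)))"

text \<open>
  The multi-index at a given position, in the order in which the first index runs fastest.
  This is the order of the square unfolding: \<open>k = i\<^sub>2 m\<^sub>1 + i\<^sub>1\<close> in 0-based form.
\<close>

fun multi_index :: "nat list \<Rightarrow> nat \<Rightarrow> nat list" where
  "multi_index [] k = []"
| "multi_index (n # ns) k = k mod n # multi_index ns (k div n)"

definition matricization :: "nat list \<Rightarrow> 'a tensor \<Rightarrow> nat \<Rightarrow> 'a mat" where
  "matricization ns F j =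
     (let rest = take j ns @ drop (Suc j) ns in
      mat (prod_list rest) (ns ! j)
        (\<lambda>(k, c). let is = multi_index rest k in F (take j is @ c # drop j is)))"

definition tucker_rank :: "nat list \<Rightarrow> 'a :: field tensor \<Rightarrow> nat list" where
  "tucker_rank ns F = map (\<lambda>j. mat_rank (matricization ns F j)) [0..<length ns]"

definition square_unfolding :: "nat list \<Rightarrow> 'a tensor \<Rightarrow> 'a mat" where
  "square_unfolding ms G =
     mat (ms ! 0 * ms ! 1) (ms ! 2 * ms ! 3)
       (\<lambda>(k, l). G [k mod ms ! 0, k div ms ! 0, l mod ms ! 2, l div ms ! 2])"

text \<open>
  The \<open>k\<close>-th index of the permuted tensor is the \<open>\<pi> k\<close>-th index of \<open>F\<close>: its sizes are
  \<open>permute_list \<pi> ns\<close>, and its entry at \<open>permute_list \<pi> is\<close> is \<open>F is\<close>.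
\<close>

definition permute_tensor :: "nat list \<Rightarrow> (nat \<Rightarrow> nat) \<Rightarrow> 'a tensor \<Rightarrow> 'a tensor" where
  "permute_tensor ns \<pi> F =
     (\<lambda>is \<in> tensor_index (permute_list \<pi> ns). F (permute_list (inv_into UNIV \<pi>) is))"

definition unfolding_ranks :: "nat list \<Rightarrow> 'a :: field tensor \<Rightarrow> nat set" where
  "unfolding_ranks ns F =
     (\<lambda>\<pi>. mat_rank (square_unfolding (permute_list \<pi> ns) (permute_tensor ns \<pi> F)))
       ` {\<pi>. \<pi> permutes {..<4}}"

definition rank_M_minus :: "nat list \<Rightarrow> 'a :: field tensor \<Rightarrow> nat" where
  "rank_M_minus ns F = Min (unfolding_ranks ns F)"

definition rank_M_plus :: "nat list \<Rightarrow> 'a :: field tensor \<Rightarrow> nat" where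
  "rank_M_plus ns F = Max (unfolding_ranks ns F)"

end

theory Submission
  imports Defs
begin

text \<open>
  Every unfolding in the statement is a Kronecker product in disguise: it
  splits the four indices of \<open>A \<otimes> B\<close> into row indices and column indices. A factor whose two
  indices are separated contributes a copy of itself or its transpose; a factor whose two indices
  stay together contributes its list of entries, as a single column or row. Since the rank of a
  Kronecker product is the product of the ranks (\<open>rank_indexed_kronecker\<close>,
  \<open>mat_rank_kronecker\<close>), a separated factor contributes its rank, and an unseparated non-zero
  factor contributes 1. A mode matricization separates exactly one factor, which gives the Tucker
  rank. A square unfolding separates both factors or none, so for non-zero factors its rank is
  \<open>r1 * r2\<close> or 1, and both values occur.

  A CP decomposition with \<open>r\<close> terms yields a sum of \<open>r\<close> products for the unfolding that
  separates both factors, hence \<open>r1 * r2 \<le> r\<close>; products of the terms of rank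
  decompositions of \<open>A\<close> and \<open>B\<close> attain this bound (\<open>rank_CP_outer\<close>).

  Multiplicativity of the rank is proved by certificates on both sides. A finite set \<open>T\<close>
  indexes the rank of \<open>f\<close> if \<open>f\<close> is a sum of products over \<open>T\<close> and if there are
  matrices \<open>x\<close>, \<open>y\<close> such that \<open>x f y\<close> is the identity matrix indexed by
  \<open>T\<close>. Gaussian elimination provides such a \<open>T\<close> for every finite matrix
  (\<open>rank_indexed_exists\<close>), no decomposition can have fewer terms than a separated set
  (\<open>separates_card_le_decomposes\<close>), and both kinds of certificates are closed under products.
\<close>

section \<open>Rank certificates for functions of two indices\<close>

text \<open>
  Every matrix below is treated as a function of a row and a column index drawn from arbitrary sets,
  so that merging, swapping and relabelling indices is a change of index sets and not a computation
  with positions. The term set \<open>T\<close> is arbitrary as well: a Kronecker product needs the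
  terms \<open>T \<times> T'\<close>.
\<close>

definition decomposes :: "('i \<Rightarrow> 'j \<Rightarrow> 'a :: field) \<Rightarrow> 'i set \<Rightarrow> 'j set \<Rightarrow> 't set \<Rightarrow> bool" where
  "decomposes f I J T \<longleftrightarrow>
     (\<exists>u v. \<forall>i\<in>I. \<forall>j\<in>J. f i j = (\<Sum>t\<in>T. u t i * v t j))"

text \<open>
  A certificate for a lower bound: the matrix product \<open>x f y\<close> is the identity indexed by
  \<open>T\<close>. It is used in place of a non-zero minor because such products multiply under the
  Kronecker product without any determinant.
\<close>

definition separates :: "('i \<Rightarrow> 'j \<Rightarrow> 'a :: field) \<Rightarrow> 'i set \<Rightarrow> 'j set \<Rightarrow> 't set \<Rightarrow> bool" where
  "separates f I J T \<longleftrightarrow>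
     (\<exists>x y. \<forall>s\<in>T. \<forall>t\<in>T. (\<Sum>j\<in>J. (\<Sum>i\<in>I. x s i * f i j) * y t j) = of_bool (s = t))"

definition rank_indexed :: "('i \<Rightarrow> 'j \<Rightarrow> 'a :: field) \<Rightarrow> 'i set \<Rightarrow> 'j set \<Rightarrow> 't set \<Rightarrow> bool" where
  "rank_indexed f I J T \<longleftrightarrow> finite T \<and> decomposes f I J T \<and> separates f I J T"

lemma rank_indexedE:
  assumes "rank_indexed f I J T"
  obtains u v x y where "finite T"
    and "\<And>i j. i \<in> I \<Longrightarrow> j \<in> J \<Longrightarrow> f i j = (\<Sum>t\<in>T. u t i * v t j)"
    and "\<And>s t. s \<in> T \<Longrightarrow> t \<in> T \<Longrightarrow>
      (\<Sum>j\<in>J. (\<Sum>i\<in>I. x s i * f i j) * y t j) = of_bool (s = t)"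
  using assms unfolding rank_indexed_def decomposes_def separates_def by blast

lemma rank_indexedI:
  assumes "finite T"
    and "\<And>i j. i \<in> I \<Longrightarrow> j \<in> J \<Longrightarrow> f i j = (\<Sum>t\<in>T. u t i * v t j)"
    and "\<And>s t. s \<in> T \<Longrightarrow> t \<in> T \<Longrightarrow>
      (\<Sum>j\<in>J. (\<Sum>i\<in>I. x s i * f i j) * y t j) = of_bool (s = t)"
  shows "rank_indexed f I J T"
  using assms unfolding rank_indexed_def decomposes_def separates_def by blast

text \<open>
  Each term has rank at most one, and rank is subadditive.
\<close>

lemma rank_le_number_of_terms:
  fixes M :: "'a :: field mat"
  assumes "finite S" "M \<in> carrier_mat n nc"
    and "\<And>i j. i < n \<Longrightarrow> j < nc \<Longrightarrow> M $$ (i, j) = (\<Sum>s\<in>S. u s i * v s j)"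
  shows "vec_space.rank n M \<le> card S"
  using assms
proof (induction S arbitrary: M rule: finite_induct)
  case empty
  then have "M = 0\<^sub>m n nc" by (intro eq_matI) auto
  then show ?case by (simp add: vec_space.rank_0I)
next
  case (insert s S)
  define P where "P = mat n nc (\<lambda>(i, j). u s i * v s j)"
  define Q where "Q = mat n nc (\<lambda>(i, j). \<Sum>s\<in>S. u s i * v s j)"
  have PQ: "P \<in> carrier_mat n nc" "Q \<in> carrier_mat n nc"
    by (auto simp: P_def Q_def)
  have "M = P + Q"
    using insert.hyps insert.prems by (intro eq_matI) (auto simp: P_def Q_def)
  moreover have "vec_space.rank n P \<le> 1"
    by (rule vec_space.rank_le_1_product_entries[OF PQ(1)]) (auto simp: P_def)
  moreover have "vec_space.rank n Q \<le> card S"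
    by (rule insert.IH) (auto simp: Q_def)
  ultimately show ?case
    using vec_space.rank_subadditive[OF PQ] insert.hyps by simp
qed

text \<open>
  Multiplying a decomposition of \<open>f\<close> by \<open>x\<close> and \<open>y\<close> writes the identity
  matrix of size \<open>card T\<close> as a sum of \<open>card S\<close> products, and the identity matrix has
  full rank. The lower bounds for Kronecker products and for the CP-rank come from here.
\<close>

lemma separates_card_le_decomposes:
  fixes f :: "'i \<Rightarrow> 'j \<Rightarrow> 'a :: field"
  assumes sep: "separates f I J T" and dec: "decomposes f I J S"
    and "finite T" "finite S"
  shows "card T \<le> card S"
proof -
  obtain x y where xy: "\<And>s t. s \<in> T \<Longrightarrow> t \<in> T \<Longrightarrow>
      (\<Sum>j\<in>J. (\<Sum>i\<in>I. x s i * f i j) * y t j) = of_bool (s = t)"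
    using sep unfolding separates_def by blast
  obtain u v where uv: "\<And>i j. i \<in> I \<Longrightarrow> j \<in> J \<Longrightarrow> f i j = (\<Sum>s\<in>S. u s i * v s j)"
    using dec unfolding decomposes_def by blast
  obtain h where h: "bij_betw h {0..<card T} T"
    using ex_bij_betw_nat_finite[OF \<open>finite T\<close>] by blast
  let ?k = "card T"
  define p where "p s a = (\<Sum>i\<in>I. x (h a) i * u s i)" for s a
  define q where "q s b = (\<Sum>j\<in>J. v s j * y (h b) j)" for s b
  have "vec_space.rank ?k (1\<^sub>m ?k :: 'a mat) \<le> card S"
  proof (rule rank_le_number_of_terms[OF \<open>finite S\<close>, where nc = ?k])
    fix a b assume ab: "a < ?k" "b < ?k"
    then have hT: "h a \<in> T" "h b \<in> T" and inj: "h a = h b \<longleftrightarrow> a = b"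
      using h by (auto simp: bij_betw_def inj_on_def)
    have "(\<Sum>s\<in>S. p s a * q s b) =
        (\<Sum>s\<in>S. \<Sum>j\<in>J. \<Sum>i\<in>I. x (h a) i * u s i * (v s j * y (h b) j))"
      unfolding p_def q_def by (simp add: sum_product sum.swap[of _ I J])
    also have "\<dots> = (\<Sum>j\<in>J. \<Sum>i\<in>I. \<Sum>s\<in>S. x (h a) i * u s i * (v s j * y (h b) j))"
      by (subst sum.swap, rule sum.cong[OF refl], rule sum.swap)
    also have "\<dots> = (\<Sum>j\<in>J. (\<Sum>i\<in>I. x (h a) i * f i j) * y (h b) j)"
      by (intro sum.cong refl)
         (simp add: uv sum_distrib_left sum_distrib_right mult.assoc)
    also have "\<dots> = of_bool (a = b)" using xy[OF hT] inj by simp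
    finally show "(1\<^sub>m ?k :: 'a mat) $$ (a, b) = (\<Sum>s\<in>S. p s a * q s b)"
      using ab by (simp add: one_mat_def)
  qed simp
  moreover have "vec_space.rank ?k (1\<^sub>m ?k :: 'a mat) = ?k"
    by (rule vec_space.low_rank_det_zero) auto
  ultimately show ?thesis by simp
qed

text \<open>
  Gaussian elimination, one row at a time. If the new row \<open>i0\<close> has a pivot \<open>p = f i0 j0\<close>,
  then \<open>g = f - f(-, j0) f(i0, -) / p\<close> vanishes on that row and in column \<open>j0\<close>. The
  subtracted product is one additional term of the decomposition, and since \<open>g\<close> vanishes in
  column \<open>j0\<close>, the certificate of \<open>g\<close> extends by one row and one column.
\<close>

lemma rank_indexed_exists:
  fixes f :: "'i \<Rightarrow> 'j \<Rightarrow> 'a :: field"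
  assumes "finite I" "finite J"
  shows "\<exists>r. rank_indexed f I J {..<r::nat}"
  using assms(1)
proof (induction I arbitrary: f rule: finite_induct)
  case empty
  have "rank_indexed f {} J {..<0::nat}"
    by (auto simp: rank_indexed_def decomposes_def separates_def)
  then show ?case ..
next
  case (insert i0 I)
  show ?case
  proof (cases "\<forall>j\<in>J. f i0 j = 0")
    case True
    obtain r where "rank_indexed f I J {..<r::nat}" using insert.IH by blast
    then obtain u v x y where
      uv: "\<And>i j. i \<in> I \<Longrightarrow> j \<in> J \<Longrightarrow> f i j = (\<Sum>t<r. u t i * v t j)" and
      xy: "\<And>s t. s \<in> {..<r} \<Longrightarrow> t \<in> {..<r} \<Longrightarrow>
        (\<Sum>j\<in>J. (\<Sum>i\<in>I. x s i * f i j) * y t j) = of_bool (s = t)"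
      by (rule rank_indexedE) blast
    have "rank_indexed f (insert i0 I) J {..<r}"
    proof (rule rank_indexedI)
      fix i j assume "i \<in> insert i0 I" "j \<in> J"
      then show "f i j = (\<Sum>t<r. (if i = i0 then 0 else u t i) * v t j)"
        using uv[of i j] True insert.hyps by (cases "i = i0") auto
    next
      fix s t assume st: "s \<in> {..<r}" "t \<in> {..<r}"
      have "(\<Sum>j\<in>J. (\<Sum>i\<in>insert i0 I. x s i * f i j) * y t j) =
          (\<Sum>j\<in>J. (\<Sum>i\<in>I. x s i * f i j) * y t j)"
        using True insert.hyps by (intro sum.cong) auto
      then show "(\<Sum>j\<in>J. (\<Sum>i\<in>insert i0 I. x s i * f i j) * y t j) = of_bool (s = t)"
        using xy[OF st] by simp
    qed simp
    then show ?thesis by blast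
  next
    case False
    then obtain j0 where j0: "j0 \<in> J" "f i0 j0 \<noteq> 0" by blast
    let ?p = "f i0 j0"
    define g where "g i j = f i j - f i j0 * f i0 j / ?p" for i j
    obtain r where "rank_indexed g I J {..<r::nat}" using insert.IH by blast
    then obtain u v x y where
      uv: "\<And>i j. i \<in> I \<Longrightarrow> j \<in> J \<Longrightarrow> g i j = (\<Sum>t<r. u t i * v t j)" and
      xy: "\<And>s t. s \<in> {..<r} \<Longrightarrow> t \<in> {..<r} \<Longrightarrow>
        (\<Sum>j\<in>J. (\<Sum>i\<in>I. x s i * g i j) * y t j) = of_bool (s = t)"
      by (rule rank_indexedE) blast
    have "decomposes f (insert i0 I) J {..<Suc r}"
      unfolding decomposes_def
    proof (intro exI ballI)
      fix i j assume "i \<in> insert i0 I" "j \<in> J"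
      then consider "i = i0" | "i \<in> I" "i \<noteq> i0" using insert.hyps by blast
      then show "f i j = (\<Sum>t<Suc r.
          (if t = r then f i j0 / ?p else if i = i0 then 0 else u t i) *
          (if t = r then f i0 j else v t j))"
      proof cases
        case 1
        then show ?thesis using j0 by simp
      next
        case 2
        then show ?thesis using uv[of i j] \<open>j \<in> J\<close> by (simp add: g_def diff_eq_eq)
      qed
    qed
    moreover have "separates f (insert i0 I) J {..<Suc r}"
      unfolding separates_def
    proof (intro exI ballI)
      fix s t assume st: "s \<in> {..<Suc r}" "t \<in> {..<Suc r}"
      \<comment> \<open>The value of X s at i0 performs the row elimination, turning f into g;
        subtracting c t at position j0 makes column t of Y orthogonal to the pivot row.\<close>
      define X where "X s i = (if s = r then of_bool (i = i0) / ?p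
          else if i = i0 then - (\<Sum>i\<in>I. x s i * f i j0) / ?p else x s i)" for s i
      define c where "c t = (\<Sum>j\<in>J. f i0 j * y t j) / ?p" for t
      define Y where "Y t j = (if t = r then of_bool (j = j0)
          else y t j - of_bool (j = j0) * c t)" for t j
      have rows: "(\<Sum>i\<in>insert i0 I. X s i * f i j) =
          (if s = r then f i0 j / ?p else \<Sum>i\<in>I. x s i * g i j)" (is "?L = ?R") for j
      proof (cases "s = r")
        case True
        have "(\<Sum>i\<in>I. X s i * f i j) = 0"
          using True insert.hyps by (intro sum.neutral) (auto simp: X_def)
        then show ?thesis using True insert.hyps by (simp add: X_def)
      next
        case False
        have "(\<Sum>i\<in>I. X s i * f i j) = (\<Sum>i\<in>I. x s i * f i j)"
          using False insert.hyps by (intro sum.cong) (auto simp: X_def)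
        moreover have "(\<Sum>i\<in>I. x s i * g i j) =
            (\<Sum>i\<in>I. x s i * f i j) - (\<Sum>i\<in>I. x s i * f i j0) * (f i0 j / ?p)"
          by (simp add: g_def algebra_simps sum_subtractf sum_distrib_left sum_distrib_right)
        ultimately show ?thesis using False insert.hyps by (simp add: X_def)
      qed
      have cols: "(\<Sum>j\<in>J. w j * Y t j) =
          (if t = r then w j0 else (\<Sum>j\<in>J. w j * y t j) - w j0 * c t)" for w
      proof -
        have delta: "(\<Sum>j\<in>J. w j * of_bool (j = j0) * d) = w j0 * d" for d
          using j0 \<open>finite J\<close> by (simp add: of_bool_def if_distrib if_distribR cong: if_cong)
        show ?thesis
          using delta[of 1] delta[of "c t"] by (simp add: Y_def right_diff_distrib sum_subtractf mult.assoc)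
      qed
      have g0: "g i j0 = 0" for i using j0 by (simp add: g_def)
      have c: "(\<Sum>j\<in>J. f i0 j / ?p * y t j) = c t"
        by (simp add: c_def sum_divide_distrib)
      show "(\<Sum>j\<in>J. (\<Sum>i\<in>insert i0 I. X s i * f i j) * Y t j) = of_bool (s = t)"
        unfolding cols rows using st j0 xy[of s t] g0 c by auto
    qed
    ultimately show ?thesis by (auto simp: rank_indexed_def)
  qed
qed

text \<open>
  A maximal independent set of columns has as many elements as the rank, and it spans every column:
  the terms are indexed by these columns, with their entries and the coefficients as factors.
\<close>

lemma decomposes_rank:
  fixes A :: "'a :: field mat"
  assumes A: "A \<in> carrier_mat n nc"
  shows "\<exists>S. finite S \<and> card S = vec_space.rank n A \<and>
           decomposes (\<lambda>i j. A $$ (i, j)) {..<n} {..<nc} (S :: 'a vec set)"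
proof -
  interpret vec_space "TYPE('a)" n .
  obtain S where S: "finite S" "maximal S (\<lambda>T. T \<subseteq> set (cols A) \<and> lin_indpt T)"
    using maximal_exists_superset[of "set (cols A)" "\<lambda>T. T \<subseteq> set (cols A) \<and> lin_indpt T" "{}"]
      finite_lin_indpt2[of "{}"] by auto
  have carr: "set (cols A) \<subseteq> carrier_vec n" using A cols_dim by blast
  have Ssub: "S \<subseteq> set (cols A)" and Sind: "lin_indpt S" using S by (auto simp: maximal_def)
  have SV: "S \<subseteq> carrier_vec n" using Ssub carr by simp
  have inspan: "w \<in> span S" if w: "w \<in> set (cols A)" for w
  proof (rule ccontr)
    assume nsp: "w \<notin> span S"
    have "w \<in> carrier_vec n" using w carr by auto
    moreover have "w \<notin> S" using nsp in_own_span[OF SV] by blast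
    ultimately have "lin_indpt (S \<union> {w})"
      using lin_dep_iff_in_span[OF SV Sind] nsp by blast
    then have "S \<union> {w} = S"
      using S(2) Ssub w unfolding maximal_def by blast
    then show False using \<open>w \<notin> S\<close> by blast
  qed
  have "\<exists>a. \<forall>i<n. A $$ (i, j) = (\<Sum>s\<in>S. s $ i * a s)" if "j < nc" for j
  proof -
    have "col A j \<in> span S" using inspan[of "col A j"] that A by (auto simp: cols_def)
    then obtain a where a: "lincomb a S = col A j"
      using finite_in_span[OF S(1) SV] by blast
    have "A $$ (i, j) = (\<Sum>s\<in>S. s $ i * a s)" if "i < n" for i
    proof -
      have "lincomb a S $ i = (\<Sum>s\<in>S. a s * s $ i)"
        using lincomb_index[OF that] Ssub carr by blast
      then show ?thesis using a A \<open>j < nc\<close> that by (simp add: mult.commute)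
    qed
    then show ?thesis by blast
  qed
  then obtain a where "\<And>i j. i < n \<Longrightarrow> j < nc \<Longrightarrow> A $$ (i, j) = (\<Sum>s\<in>S. s $ i * a j s)"
    by metis
  then have "decomposes (\<lambda>i j. A $$ (i, j)) {..<n} {..<nc} S"
    unfolding decomposes_def by (intro exI[of _ "\<lambda>s i. s $ i"] exI[of _ "\<lambda>s j. a j s"]) auto
  then show ?thesis using S(1) rank_card_indpt[OF A S(2)] by metis
qed

lemma mat_rank_eq_card:
  fixes A :: "'a :: field mat"
  assumes A: "A \<in> carrier_mat n nc"
    and T: "rank_indexed (\<lambda>i j. A $$ (i, j)) {..<n} {..<nc} T"
  shows "mat_rank A = card T"
proof (rule antisym)
  obtain u v where "\<And>i j. i \<in> {..<n} \<Longrightarrow> j \<in> {..<nc} \<Longrightarrow> A $$ (i, j) = (\<Sum>t\<in>T. u t i * v t j)"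
    using T by (rule rank_indexedE) blast
  then show "mat_rank A \<le> card T"
    using T A rank_le_number_of_terms[of T A n nc u v]
    by (simp add: mat_rank_def rank_indexed_def)
  obtain S :: "'a vec set" where "finite S" "card S = vec_space.rank n A"
    "decomposes (\<lambda>i j. A $$ (i, j)) {..<n} {..<nc} S"
    using decomposes_rank[OF A] by blast
  moreover have "card T \<le> card S"
    using separates_card_le_decomposes T calculation unfolding rank_indexed_def by blast
  ultimately show "card T \<le> mat_rank A" using A by (simp add: mat_rank_def)
qed

lemma rank_indexed_mat:
  fixes A :: "'a :: field mat"
  assumes A: "A \<in> carrier_mat n nc"
  shows "rank_indexed (\<lambda>i j. A $$ (i, j)) {..<n} {..<nc} {..<mat_rank A}"
proof -
  obtain r where "rank_indexed (\<lambda>i j. A $$ (i, j)) {..<n} {..<nc} {..<r::nat}"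
    using rank_indexed_exists[OF finite_lessThan finite_lessThan] by blast
  then show ?thesis using mat_rank_eq_card[OF A, of "{..<r}"] by simp
qed

lemma rank_indexed_swap:
  assumes "rank_indexed f I J T"
  shows "rank_indexed (\<lambda>j i. f i j) J I T"
  using assms
proof (rule rank_indexedE)
  fix u v x y
  assume fin: "finite T"
    and uv: "\<And>i j. i \<in> I \<Longrightarrow> j \<in> J \<Longrightarrow> f i j = (\<Sum>t\<in>T. u t i * v t j)"
    and xy: "\<And>s t. s \<in> T \<Longrightarrow> t \<in> T \<Longrightarrow>
      (\<Sum>j\<in>J. (\<Sum>i\<in>I. x s i * f i j) * y t j) = of_bool (s = t)"
  show ?thesis
  proof (rule rank_indexedI[OF fin])
    fix j i assume "j \<in> J" "i \<in> I"
    then show "f i j = (\<Sum>t\<in>T. v t j * u t i)" by (simp add: uv mult.commute)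
  next
    fix s t assume st: "s \<in> T" "t \<in> T"
    have "(\<Sum>i\<in>I. (\<Sum>j\<in>J. y s j * f i j) * x t i) =
        (\<Sum>j\<in>J. (\<Sum>i\<in>I. x t i * f i j) * y s j)"
      unfolding sum_distrib_left sum_distrib_right
      by (subst sum.swap) (simp add: mult_ac)
    then show "(\<Sum>i\<in>I. (\<Sum>j\<in>J. y s j * f i j) * x t i) = of_bool (s = t)"
      using xy[OF st(2,1)] by auto
  qed
qed

lemma rank_indexed_reindex:
  assumes "rank_indexed f I J T" and p: "bij_betw p I' I" and q: "bij_betw q J' J"
    and e: "\<And>i j. i \<in> I' \<Longrightarrow> j \<in> J' \<Longrightarrow> g i j = f (p i) (q j)"
  shows "rank_indexed g I' J' T"
  using assms(1)
proof (rule rank_indexedE)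
  fix u v x y
  assume fin: "finite T"
    and uv: "\<And>i j. i \<in> I \<Longrightarrow> j \<in> J \<Longrightarrow> f i j = (\<Sum>t\<in>T. u t i * v t j)"
    and xy: "\<And>s t. s \<in> T \<Longrightarrow> t \<in> T \<Longrightarrow>
      (\<Sum>j\<in>J. (\<Sum>i\<in>I. x s i * f i j) * y t j) = of_bool (s = t)"
  show ?thesis
  proof (rule rank_indexedI[OF fin])
    fix i j assume "i \<in> I'" "j \<in> J'"
    then show "g i j = (\<Sum>t\<in>T. u t (p i) * v t (q j))"
      using p q by (simp add: e uv bij_betwE)
  next
    fix s t assume st: "s \<in> T" "t \<in> T"
    have "(\<Sum>j\<in>J'. (\<Sum>i\<in>I'. x s (p i) * g i j) * y t (q j)) =
        (\<Sum>j\<in>J'. (\<Sum>i\<in>I'. x s (p i) * f (p i) (q j)) * y t (q j))"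
      by (simp add: e)
    also have "\<dots> = (\<Sum>j\<in>J. (\<Sum>i\<in>I. x s i * f i j) * y t j)"
      by (subst sum.reindex_bij_betw[OF p, of "\<lambda>i. x s i * f i (q j)" for j],
          rule sum.reindex_bij_betw[OF q])
    finally show "(\<Sum>j\<in>J'. (\<Sum>i\<in>I'. x s (p i) * g i j) * y t (q j)) = of_bool (s = t)"
      using xy[OF st] by simp
  qed
qed

text \<open>
  Tensor products of the factors decompose the Kronecker product, and tensor products of the
  separating matrices separate it, because all sums involved split over the two index pairs.
\<close>

lemma rank_indexed_kronecker:
  fixes f :: "'i \<Rightarrow> 'j \<Rightarrow> 'a :: field"
  assumes f: "rank_indexed f I J T" and g: "rank_indexed g I' J' T'"
  shows "rank_indexed (\<lambda>i j. f (fst i) (fst j) * g (snd i) (snd j)) (I \<times> I') (J \<times> J') (T \<times> T')"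
proof -
  obtain u v x y where
    uv: "\<And>i j. i \<in> I \<Longrightarrow> j \<in> J \<Longrightarrow> f i j = (\<Sum>t\<in>T. u t i * v t j)" and
    xy: "\<And>s t. s \<in> T \<Longrightarrow> t \<in> T \<Longrightarrow>
      (\<Sum>j\<in>J. (\<Sum>i\<in>I. x s i * f i j) * y t j) = of_bool (s = t)"
    using f by (rule rank_indexedE) blast
  obtain u' v' x' y' where
    uv': "\<And>i j. i \<in> I' \<Longrightarrow> j \<in> J' \<Longrightarrow> g i j = (\<Sum>t\<in>T'. u' t i * v' t j)" and
    xy': "\<And>s t. s \<in> T' \<Longrightarrow> t \<in> T' \<Longrightarrow>
      (\<Sum>j\<in>J'. (\<Sum>i\<in>I'. x' s i * g i j) * y' t j) = of_bool (s = t)"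
    using g by (rule rank_indexedE) blast
  have sum2: "(\<Sum>p\<in>K \<times> K'. a (fst p) * b (snd p)) = sum a K * sum b K'"
    for a :: "'k \<Rightarrow> 'a" and b :: "'l \<Rightarrow> 'a" and K K'
    by (simp add: sum_product sum.cartesian_product case_prod_unfold)
  let ?h = "\<lambda>i j. f (fst i) (fst j) * g (snd i) (snd j)"
  have "decomposes ?h (I \<times> I') (J \<times> J') (T \<times> T')"
    unfolding decomposes_def
  proof (intro exI ballI)
    fix i j assume ij: "i \<in> I \<times> I'" "j \<in> J \<times> J'"
    have "(\<Sum>t\<in>T \<times> T'. (u (fst t) (fst i) * u' (snd t) (snd i)) *
            (v (fst t) (fst j) * v' (snd t) (snd j))) =
          (\<Sum>t\<in>T \<times> T'. (u (fst t) (fst i) * v (fst t) (fst j)) *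
            (u' (snd t) (snd i) * v' (snd t) (snd j)))"
      by (simp add: mult_ac)
    also have "\<dots> = ?h i j"
      using ij by (subst sum2) (auto simp: uv uv')
    finally show "?h i j = (\<Sum>t\<in>T \<times> T'. (u (fst t) (fst i) * u' (snd t) (snd i)) *
            (v (fst t) (fst j) * v' (snd t) (snd j)))" ..
  qed
  moreover have "separates ?h (I \<times> I') (J \<times> J') (T \<times> T')"
    unfolding separates_def
  proof (intro exI ballI)
    fix s t assume st: "s \<in> T \<times> T'" "t \<in> T \<times> T'"
    have inner: "(\<Sum>i\<in>I \<times> I'. (x (fst s) (fst i) * x' (snd s) (snd i)) * ?h i j) =
        (\<Sum>i\<in>I. x (fst s) i * f i (fst j)) * (\<Sum>i\<in>I'. x' (snd s) i * g i (snd j))" for j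
      by (subst sum2[symmetric]) (simp add: mult_ac)
    have "(\<Sum>j\<in>J \<times> J'. (\<Sum>i\<in>I \<times> I'. (x (fst s) (fst i) * x' (snd s) (snd i)) * ?h i j) *
          (y (fst t) (fst j) * y' (snd t) (snd j))) =
        (\<Sum>j\<in>J. (\<Sum>i\<in>I. x (fst s) i * f i j) * y (fst t) j) *
        (\<Sum>j\<in>J'. (\<Sum>i\<in>I'. x' (snd s) i * g i j) * y' (snd t) j)"
      unfolding inner by (subst sum2[symmetric]) (simp add: mult_ac)
    also have "\<dots> = of_bool (s = t)"
      using st by (auto simp: xy xy' prod_eq_iff)
    finally show "(\<Sum>j\<in>J \<times> J'. (\<Sum>i\<in>I \<times> I'. (x (fst s) (fst i) * x' (snd s) (snd i)) * ?h i j) *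
          (y (fst t) (fst j) * y' (snd t) (snd j))) = of_bool (s = t)" .
  qed
  ultimately show ?thesis using f g by (auto simp: rank_indexed_def)
qed

section \<open>Kronecker products as matrices\<close>

text \<open>
  The bijections \<open>p\<close> and \<open>q\<close> say how the positions of \<open>M\<close> encode pairs of
  indices. All the ranks of unfoldings and matricizations are read off from this lemma by choosing
  \<open>p\<close> and \<open>q\<close>.
\<close>

lemma mat_rank_kronecker:
  fixes M :: "'a :: field mat"
  assumes "M \<in> carrier_mat m n"
    and "rank_indexed f I J T" "rank_indexed g I' J' T'"
    and "bij_betw p {..<m} (I \<times> I')" "bij_betw q {..<n} (J \<times> J')"
    and "\<And>k l. k < m \<Longrightarrow> l < n \<Longrightarrow>
      M $$ (k, l) = f (fst (p k)) (fst (q l)) * g (snd (p k)) (snd (q l))"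
  shows "mat_rank M = card T * card T'"
proof -
  have "rank_indexed (\<lambda>k l. M $$ (k, l)) {..<m} {..<n} (T \<times> T')"
    using assms(6)
    by (intro rank_indexed_reindex[OF rank_indexed_kronecker[OF assms(2,3)] assms(4,5)]) auto
  from mat_rank_eq_card[OF assms(1) this] show ?thesis
    by (simp add: card_cartesian_product)
qed

text \<open>
  A matrix whose two indices are merged into one has rank one or zero. Viewed as a single column, it
  is the other Kronecker factor of an unfolding that does not separate its indices.
\<close>

lemma rank_indexed_column:
  fixes c :: "'i \<Rightarrow> 'a :: field"
  assumes "finite I"
  shows "rank_indexed (\<lambda>i (_ :: unit). c i) I {()} {..<(of_bool (\<exists>i\<in>I. c i \<noteq> 0) :: nat)}"
proof (cases "\<exists>i\<in>I. c i \<noteq> 0")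
  case True
  then obtain i0 where i0: "i0 \<in> I" "c i0 \<noteq> 0" by blast
  have "(\<Sum>i\<in>I. of_bool (i = i0) / c i0 * c i) = (\<Sum>i\<in>I. if i = i0 then 1 else 0)"
    using i0 by (intro sum.cong) auto
  then have dual: "(\<Sum>i\<in>I. of_bool (i = i0) / c i0 * c i) = 1"
    using i0 assms by simp
  show ?thesis
    by (rule rank_indexedI[where u = "\<lambda>_ i. c i" and v = "\<lambda>_ _. 1"
          and x = "\<lambda>_ i. of_bool (i = i0) / c i0" and y = "\<lambda>_ _. 1"])
       (use True dual in \<open>auto simp del: sum_divide_distrib\<close>)
next
  case False
  then show ?thesis by (intro rank_indexedI) auto
qed

lemma mat_nonzero_iff:
  "A \<in> carrier_mat n nc \<Longrightarrow> (\<exists>i\<in>{..<n} \<times> {..<nc}. A $$ i \<noteq> 0) \<longleftrightarrow> A \<noteq> 0\<^sub>m n nc"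
  by (auto simp: mat_eq_iff)

lemma rank_indexed_vectorized:
  fixes A :: "'a :: field mat"
  assumes "A \<in> carrier_mat n nc"
  shows "rank_indexed (\<lambda>i (_ :: unit). A $$ i) ({..<n} \<times> {..<nc}) {()}
           {..<(of_bool (A \<noteq> 0\<^sub>m n nc) :: nat)}"
  using rank_indexed_column[of "{..<n} \<times> {..<nc}" "\<lambda>i. A $$ i"] mat_nonzero_iff[OF assms]
  by simp

lemma nonzero_le_mat_rank:
  fixes A :: "'a :: field mat"
  assumes A: "A \<in> carrier_mat n nc"
  shows "of_bool (A \<noteq> 0\<^sub>m n nc) \<le> mat_rank A"
proof (cases "mat_rank A = 0")
  case True
  have "decomposes (\<lambda>i j. A $$ (i, j)) {..<n} {..<nc} {..<mat_rank A}"
    using rank_indexed_mat[OF A] by (simp add: rank_indexed_def)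
  then have "A = 0\<^sub>m n nc"
    using A True by (auto simp: decomposes_def mat_eq_iff)
  then show ?thesis by simp
qed simp

section \<open>Merging indices\<close>

lemma mod_div_bij:
  "bij_betw (\<lambda>k. (k mod a, k div a)) {..<a * b} ({..<a} \<times> {..<b :: nat})"
proof (rule bij_betw_byWitness[where f' = "\<lambda>(i, j). i + a * j"])
  have "i + a * j < a * b" if "i < a" "j < b" for i j
  proof -
    have "i + a * j < a * Suc j" using that by simp
    also have "\<dots> \<le> a * b" using that by (intro mult_left_mono) auto
    finally show ?thesis .
  qed
  then show "(\<lambda>(i, j). i + a * j) ` ({..<a} \<times> {..<b}) \<subseteq> {..<a * b}" by auto
  show "(\<lambda>k. (k mod a, k div a)) ` {..<a * b} \<subseteq> {..<a} \<times> {..<b}"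
    by (auto simp: less_mult_imp_div_less mult.commute intro!: mod_less_divisor)
       (metis gr0I less_nat_zero_code mult_0)
qed auto

lemma bij_betw_swap_times: "bij_betw prod.swap (A \<times> B) (B \<times> A)"
  by (auto simp: bij_betw_def)

text \<open>
  Stated for a choice of positions, so that both orders of the two indices are covered at once.
\<close>

lemma mod_div_nth_bij:
  fixes a b :: nat
  assumes "i < 2" "i' < 2" "i \<noteq> i'"
  shows "bij_betw (\<lambda>k. ([k mod a, k div a] ! i, [k mod a, k div a] ! i'))
           {..<a * b} ({..<[a, b] ! i} \<times> {..<[a, b] ! i'})"
proof -
  have "bij_betw (\<lambda>k. (k div a, k mod a)) {..<a * b} ({..<b} \<times> {..<a})"
    using bij_betw_trans[OF mod_div_bij[of a b] bij_betw_swap_times] by (simp add: o_def)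
  moreover have "i = 0 \<and> i' = 1 \<or> i = 1 \<and> i' = 0" using assms by auto
  ultimately show ?thesis using mod_div_bij by auto
qed

lemma mod_div_div_bij:
  "bij_betw (\<lambda>k. (k mod a, k div a mod b, k div a div b)) {..<a * (b * c)}
     ({..<a} \<times> {..<b} \<times> {..<c :: nat})"
  using bij_betw_trans[OF mod_div_bij[of a "b * c"]
      bij_betw_map_prod[OF bij_betw_id mod_div_bij[of b c]]]
  by (simp add: o_def)

text \<open>
  The third index is split off: for the two matricizations along an index of \<open>B\<close>, the merged row index runs over the two indices of
  \<open>A\<close> first, and the remaining index of \<open>B\<close> comes last.
\<close>

lemma div_div_mod_bij:
  "bij_betw (\<lambda>k. (k div a div b, k mod a, k div a mod b)) {..<a * (b * c)}
     ({..<c :: nat} \<times> {..<a} \<times> {..<b})"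
proof -
  have "bij_betw (\<lambda>(x, y, z). (z, x, y)) ({..<a} \<times> {..<b} \<times> {..<c}) ({..<c} \<times> {..<a} \<times> {..<b})"
    by (rule bij_betw_byWitness[where f' = "\<lambda>(z, x, y). (x, y, z)"]) auto
  from bij_betw_trans[OF mod_div_div_bij this] show ?thesis
    by (simp add: o_def)
qed

lemma unit_bij: "bij_betw (\<lambda>c. (c, ())) S (S \<times> {()})"
  by (auto simp: bij_betw_def inj_on_def)

lemma unit_bij': "bij_betw (\<lambda>c. ((), c)) S ({()} \<times> S)"
  by (auto simp: bij_betw_def inj_on_def)

section \<open>Tucker rank\<close>

lemma mat_outer_entry:
  assumes "A \<in> carrier_mat n1 n2" "B \<in> carrier_mat n3 n4"
    and "i1 < n1" "i2 < n2" "i3 < n3" "i4 < n4"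
  shows "mat_outer A B [i1, i2, i3, i4] = A $$ (i1, i2) * B $$ (i3, i4)"
proof -
  have "[i1, i2, i3, i4] \<in> tensor_index [dim_row A, dim_col A, dim_row B, dim_col B]"
    using assms by (auto simp: tensor_index_def nth_Cons split: nat.split)
  then show ?thesis by (simp add: mat_outer_def)
qed

lemma mode_index_bounds:
  assumes "k < a * (b * c)"
  shows "k mod a < a" "k div a mod b < b" "k div a div b < (c :: nat)"
    and "k div a div b mod c = k div a div b"
  using bij_betwE[OF mod_div_div_bij, of a b c] assms by auto

text \<open>
  Each matricization is the Kronecker product of one matrix, possibly transposed, with the column
  formed by all entries of the other. That column has rank zero if the other matrix vanishes, which
  explains the factor \<open>of_bool\<close>.
\<close>

lemma tucker_rank_outer:
  fixes A B :: "'a :: field mat"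
  assumes A: "A \<in> carrier_mat n1 n2" and B: "B \<in> carrier_mat n3 n4"
  defines "a \<equiv> mat_rank A * of_bool (B \<noteq> 0\<^sub>m n3 n4)"
    and "b \<equiv> mat_rank B * of_bool (A \<noteq> 0\<^sub>m n1 n2)"
  shows "tucker_rank [n1, n2, n3, n4] (mat_outer A B) = [a, a, b, b]"
proof -
  let ?M = "matricization [n1, n2, n3, n4] (mat_outer A B)"
  note entry = mat_outer_entry[OF A B]
  have rank_transpose: "rank_indexed (\<lambda>j i. C $$ (i, j)) {..<nc} {..<n} {..<mat_rank C}"
    if "C \<in> carrier_mat n nc" for n nc and C :: "'a mat"
    by (rule rank_indexed_swap[OF rank_indexed_mat[OF that]])
  have "mat_rank (?M 0) = card {..<mat_rank A} * card {..<(of_bool (B \<noteq> 0\<^sub>m n3 n4) :: nat)}"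
    by (rule mat_rank_kronecker[OF _ rank_transpose[OF A] rank_indexed_vectorized[OF B]
          mod_div_div_bij unit_bij])
       (simp_all add: matricization_def Let_def entry mode_index_bounds)
  moreover have "mat_rank (?M 1) = card {..<mat_rank A} * card {..<(of_bool (B \<noteq> 0\<^sub>m n3 n4) :: nat)}"
    by (rule mat_rank_kronecker[OF _ rank_indexed_mat[OF A] rank_indexed_vectorized[OF B]
          mod_div_div_bij unit_bij])
       (simp_all add: matricization_def Let_def entry mode_index_bounds)
  moreover have "mat_rank (?M 2) = card {..<mat_rank B} * card {..<(of_bool (A \<noteq> 0\<^sub>m n1 n2) :: nat)}"
    by (rule mat_rank_kronecker[OF _ rank_transpose[OF B] rank_indexed_vectorized[OF A]
          div_div_mod_bij unit_bij])
       (simp_all add: matricization_def Let_def entry mode_index_bounds)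
  moreover have "mat_rank (?M 3) = card {..<mat_rank B} * card {..<(of_bool (A \<noteq> 0\<^sub>m n1 n2) :: nat)}"
    by (rule mat_rank_kronecker[OF _ rank_indexed_mat[OF B] rank_indexed_vectorized[OF A]
          div_div_mod_bij unit_bij])
       (simp_all add: matricization_def Let_def entry mode_index_bounds)
  ultimately show ?thesis
    by (simp add: tucker_rank_def a_def b_def upt_rec eval_nat_numeral)
qed

section \<open>Square unfoldings\<close>

lemma permuted_entry:
  fixes \<pi> :: "nat \<Rightarrow> nat"
  defines "\<sigma> \<equiv> inv_into UNIV \<pi>"
  assumes A: "A \<in> carrier_mat n1 n2" and B: "B \<in> carrier_mat n3 n4"
    and \<pi>: "\<pi> permutes {..<4}"
    and idx: "is \<in> tensor_index (permute_list \<pi> [n1, n2, n3, n4])"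
  shows "permute_tensor [n1, n2, n3, n4] \<pi> (mat_outer A B) is =
    A $$ (is ! \<sigma> 0, is ! \<sigma> 1) * B $$ (is ! \<sigma> 2, is ! \<sigma> 3)"
proof -
  let ?ns = "[n1, n2, n3, n4]"
  have len: "length is = 4" using idx by (simp add: tensor_index_def)
  have \<sigma>: "\<sigma> permutes {..<4}" unfolding \<sigma>_def by (rule permutes_inv[OF \<pi>])
  have bound: "is ! \<sigma> k < ?ns ! k" if "k < 4" for k
  proof -
    have "\<sigma> k < 4" using permutes_in_image[OF \<sigma>, of k] that by simp
    then have "is ! \<sigma> k < permute_list \<pi> ?ns ! \<sigma> k"
      using idx by (simp add: tensor_index_def)
    also have "\<dots> = ?ns ! \<pi> (\<sigma> k)"
      using \<pi> \<open>\<sigma> k < 4\<close> by (subst permute_list_nth) (simp_all add: eval_nat_numeral)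
    finally show ?thesis unfolding \<sigma>_def using permutes_inverses(1)[OF \<pi>] by simp
  qed
  have "permute_list \<sigma> is = [is ! \<sigma> 0, is ! \<sigma> 1, is ! \<sigma> 2, is ! \<sigma> 3]"
    by (simp add: permute_list_def len upt_rec eval_nat_numeral)
  then show ?thesis
    using idx bound[of 0] bound[of 1] bound[of 2] bound[of 3]
    by (simp add: permute_tensor_def \<sigma>_def[symmetric] mat_outer_entry[OF A B])
qed

text \<open>
  Position \<open>s0\<close> of the permuted multi-index carries the first index of \<open>A\<close>, and so on;
  positions 0 and 1 form the row index. Only the induced partition of the indices matters. If the two
  indices of \<open>A\<close> lie on the same side, then so do those of \<open>B\<close>, and the unfolding is a
  column times a row. Otherwise it is the Kronecker product of \<open>A\<close> or its transpose with
  \<open>B\<close> or its transpose.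
\<close>

lemma square_unfolding_outer_rank:
  fixes A B :: "'a :: field mat"
  assumes A: "A \<in> carrier_mat n1 n2" and B: "B \<in> carrier_mat n3 n4"
    and s: "s0 < 4" "s1 < 4" "s2 < 4" "s3 < 4" "distinct [s0, s1, s2, s3]"
    and m: "[m0, m1, m2, m3] ! s0 = n1" "[m0, m1, m2, m3] ! s1 = n2"
      "[m0, m1, m2, m3] ! s2 = n3" "[m0, m1, m2, m3] ! s3 = n4"
    and M: "M \<in> carrier_mat (m0 * m1) (m2 * m3)"
    and entries: "\<And>k l. k < m0 * m1 \<Longrightarrow> l < m2 * m3 \<Longrightarrow>
      M $$ (k, l) = (let js = [k mod m0, k div m0] @ [l mod m2, l div m2] in
        A $$ (js ! s0, js ! s1) * B $$ (js ! s2, js ! s3))"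
  shows "mat_rank M = (if s0 < 2 \<longleftrightarrow> s1 < 2
    then of_bool (A \<noteq> 0\<^sub>m n1 n2) * of_bool (B \<noteq> 0\<^sub>m n3 n4) else mat_rank A * mat_rank B)"
proof -
  define rix where "rix k = [k mod m0, k div m0]" for k
  define cix where "cix l = [l mod m2, l div m2]" for l
  have rbij: "bij_betw (\<lambda>k. (rix k ! i, rix k ! i')) {..<m0 * m1} ({..<a} \<times> {..<b})"
    if "i < 2" "i' < 2" "i \<noteq> i'" "[m0, m1, m2, m3] ! i = a" "[m0, m1, m2, m3] ! i' = b" for i i' a b
  proof -
    have "[m0, m1] ! i = a" "[m0, m1] ! i' = b" using that by (auto simp: less_Suc_eq numeral_2_eq_2)
    then show ?thesis using mod_div_nth_bij[OF that(1-3), of m0 m1] by (simp add: rix_def)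
  qed
  have cbij: "bij_betw (\<lambda>l. (cix l ! (i - 2), cix l ! (i' - 2))) {..<m2 * m3} ({..<a} \<times> {..<b})"
    if "\<not> i < 2" "\<not> i' < 2" "i < 4" "i' < 4" "i \<noteq> i'"
      "[m0, m1, m2, m3] ! i = a" "[m0, m1, m2, m3] ! i' = b" for i i' a b
  proof -
    have "[m2, m3] ! (i - 2) = a" "[m2, m3] ! (i' - 2) = b"
      using that by (auto simp: less_Suc_eq eval_nat_numeral)
    then show ?thesis using mod_div_nth_bij[of "i - 2" "i' - 2" m2 m3] that by (simp add: cix_def)
  qed
  have pick: "(rix k @ cix l) ! i = (if i < 2 then rix k ! i else cix l ! (i - 2))" for k l i
  proof -
    have "length (rix k) = 2" by (simp add: rix_def)
    then show ?thesis by (simp add: nth_append)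
  qed
  have ent: "M $$ (k, l) = A $$ ((rix k @ cix l) ! s0, (rix k @ cix l) ! s1) *
      B $$ ((rix k @ cix l) ! s2, (rix k @ cix l) ! s3)" if "k < m0 * m1" "l < m2 * m3" for k l
    using entries[OF that] unfolding Let_def rix_def cix_def .
  have AT: "rank_indexed (\<lambda>j i. A $$ (i, j)) {..<n2} {..<n1} {..<mat_rank A}"
    by (rule rank_indexed_swap[OF rank_indexed_mat[OF A]])
  have BT: "rank_indexed (\<lambda>j i. B $$ (i, j)) {..<n4} {..<n3} {..<mat_rank B}"
    by (rule rank_indexed_swap[OF rank_indexed_mat[OF B]])
  have Arow: "rank_indexed (\<lambda>(_ :: unit) i. A $$ i) {()} ({..<n1} \<times> {..<n2})
      {..<(of_bool (A \<noteq> 0\<^sub>m n1 n2) :: nat)}"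
    by (rule rank_indexed_swap[OF rank_indexed_vectorized[OF A]])
  have Brow: "rank_indexed (\<lambda>(_ :: unit) i. B $$ i) {()} ({..<n3} \<times> {..<n4})
      {..<(of_bool (B \<noteq> 0\<^sub>m n3 n4) :: nat)}"
    by (rule rank_indexed_swap[OF rank_indexed_vectorized[OF B]])
  have ne: "s0 \<noteq> s1" "s0 \<noteq> s2" "s0 \<noteq> s3" "s1 \<noteq> s2" "s1 \<noteq> s3" "s2 \<noteq> s3" using s by auto
  have no_three: "\<not> (i < 2 \<and> j < 2 \<and> k < 2)" "\<not> (\<not> i < 2 \<and> \<not> j < 2 \<and> \<not> k < 2 \<and> i < 4 \<and> j < 4 \<and> k < 4)"
    if "i \<noteq> j" "j \<noteq> k" "i \<noteq> k" for i j k :: nat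
    using that by linarith+
  consider (rows) "s0 < 2" "s1 < 2" "\<not> s2 < 2" "\<not> s3 < 2"
    | (cols) "\<not> s0 < 2" "\<not> s1 < 2" "s2 < 2" "s3 < 2"
    | (both) "s0 < 2" "\<not> s1 < 2" "s2 < 2" "\<not> s3 < 2"
    | (flipB) "s0 < 2" "\<not> s1 < 2" "\<not> s2 < 2" "s3 < 2"
    | (flipA) "\<not> s0 < 2" "s1 < 2" "s2 < 2" "\<not> s3 < 2"
    | (flip) "\<not> s0 < 2" "s1 < 2" "\<not> s2 < 2" "s3 < 2"
    using s no_three[of s0 s1 s2] no_three[of s0 s1 s3] no_three[of s0 s2 s3] no_three[of s1 s2 s3] ne
    by blast
  then show ?thesis
  proof cases
    case rows
    have "mat_rank M = card {..<(of_bool (A \<noteq> 0\<^sub>m n1 n2) :: nat)} *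
        card {..<(of_bool (B \<noteq> 0\<^sub>m n3 n4) :: nat)}"
      by (rule mat_rank_kronecker[OF M rank_indexed_vectorized[OF A] Brow
            bij_betw_trans[OF rbij[of s0 s1] unit_bij] bij_betw_trans[OF cbij[of s2 s3] unit_bij']])
         (use rows s(1-4) ne(1,6) m in \<open>simp_all add: ent pick\<close>)
    then show ?thesis using rows by simp
  next
    case cols
    have "mat_rank M = card {..<(of_bool (B \<noteq> 0\<^sub>m n3 n4) :: nat)} *
        card {..<(of_bool (A \<noteq> 0\<^sub>m n1 n2) :: nat)}"
      by (rule mat_rank_kronecker[OF M rank_indexed_vectorized[OF B] Arow
            bij_betw_trans[OF rbij[of s2 s3] unit_bij] bij_betw_trans[OF cbij[of s0 s1] unit_bij']])
         (use cols s(1-4) ne(1,6) m in \<open>simp_all add: ent pick\<close>)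
    then show ?thesis using cols by simp
  next
    case both
    have "mat_rank M = card {..<mat_rank A} * card {..<mat_rank B}"
      by (rule mat_rank_kronecker[OF M rank_indexed_mat[OF A] rank_indexed_mat[OF B]
            rbij[of s0 s2] cbij[of s1 s3]])
         (use both s(1-4) ne(2,5) m in \<open>simp_all add: ent pick\<close>)
    then show ?thesis using both by simp
  next
    case flipB
    have "mat_rank M = card {..<mat_rank A} * card {..<mat_rank B}"
      by (rule mat_rank_kronecker[OF M rank_indexed_mat[OF A] BT
            rbij[of s0 s3] cbij[of s1 s2]])
         (use flipB s(1-4) ne(3,4) m in \<open>simp_all add: ent pick\<close>)
    then show ?thesis using flipB by simp
  next
    case flipA
    have "mat_rank M = card {..<mat_rank A} * card {..<mat_rank B}"
      by (rule mat_rank_kronecker[OF M AT rank_indexed_mat[OF B]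
            rbij[of s1 s2] cbij[of s0 s3]])
         (use flipA s(1-4) ne(4,3) m in \<open>simp_all add: ent pick\<close>)
    then show ?thesis using flipA by simp
  next
    case flip
    have "mat_rank M = card {..<mat_rank A} * card {..<mat_rank B}"
      by (rule mat_rank_kronecker[OF M AT BT rbij[of s1 s3] cbij[of s0 s2]])
         (use flip s(1-4) ne(5,2) m in \<open>simp_all add: ent pick\<close>)
    then show ?thesis using flip by simp
  qed
qed

lemma unfolding_rank_outer:
  fixes A B :: "'a :: field mat" and \<pi> :: "nat \<Rightarrow> nat"
  defines "\<sigma> \<equiv> inv_into UNIV \<pi>"
  assumes A: "A \<in> carrier_mat n1 n2" and B: "B \<in> carrier_mat n3 n4"
    and \<pi>: "\<pi> permutes {..<4}"
  shows "mat_rank (square_unfolding (permute_list \<pi> [n1, n2, n3, n4])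
      (permute_tensor [n1, n2, n3, n4] \<pi> (mat_outer A B))) =
    (if \<sigma> 0 < 2 \<longleftrightarrow> \<sigma> 1 < 2
     then of_bool (A \<noteq> 0\<^sub>m n1 n2) * of_bool (B \<noteq> 0\<^sub>m n3 n4) else mat_rank A * mat_rank B)"
proof -
  let ?ns = "[n1, n2, n3, n4]"
  have \<sigma>: "\<sigma> permutes {..<4}" unfolding \<sigma>_def by (rule permutes_inv[OF \<pi>])
  have \<pi>\<sigma>: "\<pi> (\<sigma> k) = k" for k unfolding \<sigma>_def using permutes_inverses(1)[OF \<pi>] .
  have \<sigma>4: "\<sigma> k < 4" if "k < 4" for k using permutes_in_image[OF \<sigma>, of k] that by simp
  have inj: "\<sigma> i = \<sigma> j \<longleftrightarrow> i = j" for i j using permutes_inj[OF \<sigma>] by (auto dest: injD)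
  obtain m0 m1 m2 m3 where ms: "permute_list \<pi> ?ns = [m0, m1, m2, m3]"
    by (simp add: permute_list_def upt_rec)
  have m: "[m0, m1, m2, m3] ! \<sigma> k = ?ns ! k" if "k < 4" for k
    unfolding ms[symmetric] using \<pi> \<sigma>4[OF that] \<pi>\<sigma>
    by (subst permute_list_nth) (simp_all add: eval_nat_numeral)
  show ?thesis unfolding ms
  proof (rule square_unfolding_outer_rank[OF A B])
    show "\<sigma> 0 < 4" "\<sigma> 1 < 4" "\<sigma> 2 < 4" "\<sigma> 3 < 4" by (simp_all add: \<sigma>4)
    show "distinct [\<sigma> 0, \<sigma> 1, \<sigma> 2, \<sigma> 3]" by (simp add: inj)
    show "[m0, m1, m2, m3] ! \<sigma> 0 = n1" "[m0, m1, m2, m3] ! \<sigma> 1 = n2"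
      "[m0, m1, m2, m3] ! \<sigma> 2 = n3" "[m0, m1, m2, m3] ! \<sigma> 3 = n4"
      by (simp_all add: m)
    show "square_unfolding [m0, m1, m2, m3] (permute_tensor ?ns \<pi> (mat_outer A B))
        \<in> carrier_mat (m0 * m1) (m2 * m3)"
      by (simp add: square_unfolding_def)
  next
    fix k l assume kl: "k < m0 * m1" "l < m2 * m3"
    let ?js = "[k mod m0, k div m0, l mod m2, l div m2]"
    have "?js \<in> tensor_index (permute_list \<pi> ?ns)"
      unfolding ms using bij_betwE[OF mod_div_bij, of m0 m1] bij_betwE[OF mod_div_bij, of m2 m3] kl
      by (auto simp: tensor_index_def nth_Cons split: nat.split)
    then show "square_unfolding [m0, m1, m2, m3] (permute_tensor ?ns \<pi> (mat_outer A B)) $$ (k, l) =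
        (let js = [k mod m0, k div m0] @ [l mod m2, l div m2] in
          A $$ (js ! \<sigma> 0, js ! \<sigma> 1) * B $$ (js ! \<sigma> 2, js ! \<sigma> 3))"
      using kl permuted_entry[OF A B \<pi>]
      by (simp add: square_unfolding_def \<sigma>_def Let_def eval_nat_numeral)
  qed
qed

text \<open>
  Exchanging the second and the third index puts one index of each matrix into the row index, so this
  permutation attains the maximal unfolding rank; the identity attains the minimal one.
\<close>

lemma straddling_permutation:
  defines "\<tau> \<equiv> Transposition.transpose (1 :: nat) 2"
  shows "\<tau> permutes {..<4}" "inv_into UNIV \<tau> = \<tau>" "\<tau> 0 = 0" "\<tau> 1 = 2"
proof -
  show "\<tau> permutes {..<4}" unfolding \<tau>_def by (rule permutes_swap_id) auto
  show "inv_into UNIV \<tau> = \<tau>" unfolding \<tau>_def by (rule inv_transpose_eq)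
  show "\<tau> 0 = 0" "\<tau> 1 = 2" by (simp_all add: \<tau>_def transpose_def)
qed

section \<open>CP-rank\<close>

text \<open>
  Multiplying decompositions of \<open>A\<close> and \<open>B\<close> gives the upper bound. Conversely, grouping
  the first with the third and the second with the fourth factor of each term of a CP decomposition
  turns it into a decomposition of the Kronecker product of \<open>A\<close> and \<open>B\<close>, whose
  separating matrices bound the number of terms from below.
\<close>

lemma rank_CP_outer:
  fixes A B :: "'a :: field mat"
  assumes A: "A \<in> carrier_mat n1 n2" and B: "B \<in> carrier_mat n3 n4"
  shows "rank_CP [n1, n2, n3, n4] (mat_outer A B) = mat_rank A * mat_rank B"
proof -
  let ?ns = "[n1, n2, n3, n4]"
  have len: "length ?ns = 4" by simp
  have term_entry: "vec_outer 4 b [i1, i2, i3, i4] = b 0 $ i1 * b 1 $ i2 * b 2 $ i3 * b 3 $ i4"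
    if "\<And>k. k < 4 \<Longrightarrow> b k \<in> carrier_vec (?ns ! k)" "i1 < n1" "i2 < n2" "i3 < n3" "i4 < n4"
    for b :: "nat \<Rightarrow> 'a vec" and i1 i2 i3 i4
  proof -
    have "map (\<lambda>k. dim_vec (b k)) [0..<4] = ?ns"
      using that(1)[of 0] that(1)[of 1] that(1)[of 2] that(1)[of 3]
      by (simp add: upt_rec eval_nat_numeral)
    moreover have "[i1, i2, i3, i4] \<in> tensor_index ?ns"
      using that(2-) by (auto simp: tensor_index_def nth_Cons split: nat.split)
    ultimately show ?thesis
      by (simp add: vec_outer_def lessThan_Suc eval_nat_numeral mult_ac)
  qed
  have index: "is \<in> tensor_index ?ns \<longleftrightarrow>
      (\<exists>i1<n1. \<exists>i2<n2. \<exists>i3<n3. \<exists>i4<n4. is = [i1, i2, i3, i4])" for "is"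
    by (auto simp: tensor_index_def length_Suc_conv nth_Cons All_less_Suc2 split: nat.split)
  show ?thesis
    unfolding rank_CP_def len
  proof (rule Least_equality)
    obtain u v x y where uv: "\<And>i j. i \<in> {..<n1} \<Longrightarrow> j \<in> {..<n2} \<Longrightarrow>
        A $$ (i, j) = (\<Sum>t<mat_rank A. u t i * v t j)"
      using rank_indexed_mat[OF A] by (rule rank_indexedE) blast
    obtain u' v' x' y' where uv': "\<And>i j. i \<in> {..<n3} \<Longrightarrow> j \<in> {..<n4} \<Longrightarrow>
        B $$ (i, j) = (\<Sum>t<mat_rank B. u' t i * v' t j)"
      using rank_indexed_mat[OF B] by (rule rank_indexedE) blast
    define a where "a k i = (let s = i mod mat_rank A; t = i div mat_rank A in
      [vec n1 (u s), vec n2 (v s), vec n3 (u' t), vec n4 (v' t)] ! k)" for k i :: nat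
    have a: "a k i \<in> carrier_vec (?ns ! k)" if "k < 4" for k i
      using that by (auto simp: a_def Let_def less_Suc_eq eval_nat_numeral)
    have "mat_outer A B is = (\<Sum>i<mat_rank A * mat_rank B. vec_outer 4 (\<lambda>k. a k i) is)"
      if mem: "is \<in> tensor_index ?ns" for "is"
    proof -
      obtain i1 i2 i3 i4 where i: "is = [i1, i2, i3, i4]" "i1 < n1" "i2 < n2" "i3 < n3" "i4 < n4"
        using index[THEN iffD1, OF mem] by blast
      have "mat_outer A B is = (\<Sum>s<mat_rank A. u s i1 * v s i2) * (\<Sum>t<mat_rank B. u' t i3 * v' t i4)"
        using i by (simp add: mat_outer_entry[OF A B] uv uv')
      also have "\<dots> = (\<Sum>(s, t)\<in>{..<mat_rank A} \<times> {..<mat_rank B}.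
          (u s i1 * v s i2) * (u' t i3 * v' t i4))"
        by (simp add: sum_product sum.cartesian_product)
      also have "\<dots> = (\<Sum>i<mat_rank A * mat_rank B. vec_outer 4 (\<lambda>k. a k i) is)"
        by (subst sum.reindex_bij_betw[OF mod_div_bij, symmetric])
           (use i a in \<open>simp add: term_entry a_def Let_def mult_ac\<close>)
      finally show ?thesis .
    qed
    then show "\<exists>a. (\<forall>k<4. \<forall>i<mat_rank A * mat_rank B. a k i \<in> carrier_vec (?ns ! k)) \<and>
      (\<forall>is\<in>tensor_index ?ns. mat_outer A B is =
        (\<Sum>i<mat_rank A * mat_rank B. vec_outer 4 (\<lambda>k. a k i) is))"
      using a by blast
  next
    fix r
    assume "\<exists>a :: nat \<Rightarrow> nat \<Rightarrow> 'a vec. (\<forall>k<4. \<forall>i<r. a k i \<in> carrier_vec (?ns ! k)) \<and>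
      (\<forall>is\<in>tensor_index ?ns. mat_outer A B is = (\<Sum>i<r. vec_outer 4 (\<lambda>k. a k i) is))"
    then obtain a :: "nat \<Rightarrow> nat \<Rightarrow> 'a vec" where
      a: "\<And>k i. k < 4 \<Longrightarrow> i < r \<Longrightarrow> a k i \<in> carrier_vec (?ns ! k)" and
      sum: "\<And>is. is \<in> tensor_index ?ns \<Longrightarrow>
        mat_outer A B is = (\<Sum>i<r. vec_outer 4 (\<lambda>k. a k i) is)" by blast
    let ?h = "\<lambda>i j. A $$ (fst i, fst j) * B $$ (snd i, snd j)"
    have "decomposes ?h ({..<n1} \<times> {..<n3}) ({..<n2} \<times> {..<n4}) {..<r}"
      unfolding decomposes_def
    proof (intro exI ballI)
      fix i j assume "i \<in> {..<n1} \<times> {..<n3}" "j \<in> {..<n2} \<times> {..<n4}"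
      then obtain i1 i2 i3 i4 where i: "i = (i1, i3)" "j = (i2, i4)"
        "i1 < n1" "i2 < n2" "i3 < n3" "i4 < n4" by auto
      have "?h i j = mat_outer A B [i1, i2, i3, i4]"
        using i by (simp add: mat_outer_entry[OF A B])
      also have "\<dots> = (\<Sum>t<r. vec_outer 4 (\<lambda>k. a k t) [i1, i2, i3, i4])"
        using i index by (intro sum) auto
      also have "\<dots> = (\<Sum>t<r. (a 0 t $ fst i * a 2 t $ snd i) * (a 1 t $ fst j * a 3 t $ snd j))"
        using i a by (intro sum.cong refl) (simp add: term_entry mult_ac)
      finally show "?h i j = (\<Sum>t<r. (a 0 t $ fst i * a 2 t $ snd i) * (a 1 t $ fst j * a 3 t $ snd j))" .
    qed
    moreover have "separates ?h ({..<n1} \<times> {..<n3}) ({..<n2} \<times> {..<n4})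
        ({..<mat_rank A} \<times> {..<mat_rank B})"
      using rank_indexed_kronecker[OF rank_indexed_mat[OF A] rank_indexed_mat[OF B]]
      by (simp add: rank_indexed_def)
    ultimately have "card ({..<mat_rank A} \<times> {..<mat_rank B}) \<le> card {..<r}"
      by (intro separates_card_le_decomposes) auto
    then show "mat_rank A * mat_rank B \<le> r" by (simp add: card_cartesian_product)
  qed
qed

theorem mainTheorem3:
  fixes A B :: "complex mat" and F :: "complex tensor"
    and n1 n2 n3 n4 r1 r2 :: nat
  assumes "A \<in> carrier_mat n1 n2"
    and "B \<in> carrier_mat n3 n4"
    and "F \<in> carrier_tensor [n1, n2, n3, n4]"
    and "F = mat_outer A B"
    and "r1 = mat_rank A"
    and "r2 = mat_rank B"
  shows "((A = 0\<^sub>m n1 n2 \<longleftrightarrow> B = 0\<^sub>m n3 n4) \<longrightarrow>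
            tucker_rank [n1, n2, n3, n4] F = [r1, r1, r2, r2]) \<and>
         rank_M_plus [n1, n2, n3, n4] F = r1 * r2 \<and>
         (A \<noteq> 0\<^sub>m n1 n2 \<and> B \<noteq> 0\<^sub>m n3 n4 \<longrightarrow>
            rank_M_minus [n1, n2, n3, n4] F = 1) \<and>
         rank_CP [n1, n2, n3, n4] F = r1 * r2"
proof -
  note A = assms(1) and B = assms(2)
  let ?ns = "[n1, n2, n3, n4]"
  let ?nz = "of_bool (A \<noteq> 0\<^sub>m n1 n2) * of_bool (B \<noteq> 0\<^sub>m n3 n4) :: nat"
  have rank0: "mat_rank (0\<^sub>m n nc :: complex mat) = 0" for n nc
    by (simp add: mat_rank_def vec_space.rank_0I)
  have le: "?nz \<le> r1 * r2"
    unfolding assms(5,6) by (rule mult_mono[OF nonzero_le_mat_rank[OF A] nonzero_le_mat_rank[OF B]]) auto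
  have fin: "finite (unfolding_ranks ?ns F)"
    unfolding unfolding_ranks_def by (intro finite_imageI finite_permutations) simp
  have sub: "unfolding_ranks ?ns F \<subseteq> {?nz, r1 * r2}"
    unfolding unfolding_ranks_def using unfolding_rank_outer[OF A B] assms(4-6) by auto
  have nz_mem: "?nz \<in> unfolding_ranks ?ns F"
    unfolding unfolding_ranks_def
    by (rule image_eqI[of _ _ id])
       (use unfolding_rank_outer[OF A B permutes_id[of "{..<4}"]] assms(4) in \<open>auto simp: permutes_id\<close>)
  have prod_mem: "r1 * r2 \<in> unfolding_ranks ?ns F"
    unfolding unfolding_ranks_def
    by (rule image_eqI[of _ _ "Transposition.transpose 1 2"])
       (use unfolding_rank_outer[OF A B straddling_permutation(1)] straddling_permutation assms(4-6) in auto)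
  have "rank_M_plus ?ns F = r1 * r2"
    unfolding rank_M_plus_def using fin sub le prod_mem by (intro Max_eqI) auto
  moreover have "rank_M_minus ?ns F = ?nz"
    unfolding rank_M_minus_def using fin sub le nz_mem by (intro Min_eqI) auto
  moreover have "tucker_rank ?ns F = [r1, r1, r2, r2]"
    if "A = 0\<^sub>m n1 n2 \<longleftrightarrow> B = 0\<^sub>m n3 n4"
    using that tucker_rank_outer[OF A B] assms(4-6) rank0 by auto
  ultimately show ?thesis
    using rank_CP_outer[OF A B] assms(4-6) by simp
qed

end
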